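(* Let $\boldsymbol{\theta}=(\theta_0,\theta_1,\theta_t,\theta_\infty)\in\mathbb{C}^4$. Let $\mathcal{R}_1^{\boldsymbol{\theta}},\mathcal{R}_2^{\boldsymbol{\theta}}\in\mathbb{C}(y,Z,t,q)$ be the (well-defined) rational functions in four variables such that the modified $q$-Painlevé VI equation $q\widetilde{P}_{\mathrm{VI}}(\boldsymbol{\Theta})$ with spectral data $\boldsymbol{\Theta}=(\Theta_0,\Theta_1,\Theta_t,\Theta_\infty)$, $\Theta_i:=1+(q-1)\frac{\theta_i}{2}$, reads $$\left\{\begin{array}{rcl}\partial_{q,t}y&=&\phantom{+}\partial_{q,Z}H^{\boldsymbol{\theta}}_{\mathrm{VI}}(y,Z,t)+(q-1)\mathcal{R}_1^{\boldsymbol{\theta}}(y,Z,t,q)\\ \partial_{q,t}Z&=&-\partial_{q,y}H^{\boldsymbol{\theta}}_{\mathrm{VI}}(y,Z,t)+(q-1)\mathcal{R}_2^{\boldsymbol{\theta}}(y,Z,t,q)\end{array}\right.$$ via the operator identity $1+t(q-1)\partial_{q,t}=\sigma_{q,t}$. Let $\mathcal{R}\in\{\mathcal{R}_1^{\boldsymbol{\theta}},\mathcal{R}_2^{\boldsymbol{\theta}}\}$. Then the divisor $\{q=1\}$ in $\mathbb{C}^4_{y,Z,t,q}$ is not an irreducible component of the polar divisor of $\mathcal{R}$. Moreover, the polar locus of the therefore well-defined rational function $\mathcal{R}|_{q=1}$ on $\mathbb{C}^3_{y,Z,t}$ is contained in the set $$\mathcal{P}:=\{y=0\}\cup\{y=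1\}\cup\{y=t\}\cup\{t=0\}\cup\{t=1\}.$$
   Context: The Hamiltonian $H^{\boldsymbol{\theta}}_{\mathrm{VI}}\in\mathbb{C}(y,Z,t)$ is $$H^{\boldsymbol{\theta}}_{\mathrm{VI}}(y,Z,t)=\frac{y(y-1)(y-t)}{t(t-1)}\left(Z^2+\frac{Z}{y-t}\right)-\frac14\left(\frac{(\theta_\infty-1)^2-1}{t(t-1)}y+\frac{\theta_0^2}{(t-1)y}+\frac{\theta_t^2}{y-t}-\frac{\theta_1^2}{t(y-1)}\right).$$ For a variable $\zeta$: $\sigma_{q,\zeta}f(\zeta)=f(q\zeta)$ and $\partial_{q,\zeta}f(\zeta)=\frac{f(q\zeta)-f(\zeta)}{(q-1)\zeta}$ (for $H^{\boldsymbol{\theta}}_{\mathrm{VI}}$, the operators $\partial_{q,Z}$ and $\partial_{q,y}$ act with the other two variables fixed). For $\boldsymbol{\Theta}=(\Theta_0,\Theta_1,\Theta_t,\Theta_\infty)$, the modified $q$-Painlevé VI equation $q\widetilde{P}_{\mathrm{VI}}(\boldsymbol{\Theta})$ is the system $\sigma_{q,t}y=f$, $\sigma_{q,t}Z=g$, where $f,g$ are the rational functions of $(y,Z,t,q,\boldsymbol{\Theta})$ given by $$X=\frac{(y-1)(y-t)(1+(q-1)yZ)}{(y-\Theta_1)(y-\Theta_1^{-1})},\qquad f=\frac1y\cdot\frac{(X-t\Theta_0)(X-t\Theta_0^{-1})}{\left(X-\frac{\Theta_\infty}{q}\right)\left(X-\Theta_\infty^{-1}\right)},$$ $$g=\frac{1}{(q-1)f}\left(\frac{(f-qt\Theta_t)(f-qt\Theta_t^{-1})}{q(f-1)(f-qt)X}-1\right).$$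 Thus, after substituting $\Theta_i=1+(q-1)\theta_i/2$, $$\mathcal{R}_1^{\boldsymbol{\theta}}=\frac{1}{q-1}\left(\frac{f-y}{(q-1)t}-\partial_{q,Z}H^{\boldsymbol{\theta}}_{\mathrm{VI}}\right),\qquad \mathcal{R}_2^{\boldsymbol{\theta}}=\frac{1}{q-1}\left(\frac{g-Z}{(q-1)t}+\partial_{q,y}H^{\boldsymbol{\theta}}_{\mathrm{VI}}\right).$$ *)

theory Defs
  imports
    "HOL-Computational_Algebra.Computational_Algebra"
    "HOL-Computational_Algebra.Field_as_Ring"
begin

section \<open>Formulas over an arbitrary field\<close>

definition qderiv :: "'a::field \<Rightarrow> ('a \<Rightarrow> 'a) \<Rightarrow> 'a \<Rightarrow> 'a" where
  "qderiv q h \<zeta> = (h (q * \<zeta>) - h \<zeta>) / ((q - 1) * \<zeta>)"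

definition H_VI :: "'a::field \<Rightarrow> 'a \<Rightarrow> 'a \<Rightarrow> 'a \<Rightarrow> 'a \<Rightarrow> 'a \<Rightarrow> 'a \<Rightarrow> 'a" where
  "H_VI \<theta>0 \<theta>1 \<theta>t \<theta>inf y Z t =
     y * (y - 1) * (y - t) / (t * (t - 1)) * (Z^2 + Z / (y - t))
     - 1 / 4 * (((\<theta>inf - 1)^2 - 1) / (t * (t - 1)) * y + \<theta>0^2 / ((t - 1) * y)
                + \<theta>t^2 / (y - t) - \<theta>1^2 / (t * (y - 1)))"

text \<open>
  The modified equation is \<open>y(q t) = qP_f \<dots>\<close>, \<open>Z(q t) = qP_g \<dots>\<close>, with spectral data in the order
  \<open>\<Theta>0 \<Theta>1 \<Theta>t \<Theta>inf\<close>.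
\<close>

definition qP_X :: "'a::field \<Rightarrow> 'a \<Rightarrow> 'a \<Rightarrow> 'a \<Rightarrow> 'a \<Rightarrow> 'a" where
  "qP_X \<Theta>1 y Z t q =
     (y - 1) * (y - t) * (1 + (q - 1) * y * Z) / ((y - \<Theta>1) * (y - inverse \<Theta>1))"

definition qP_f :: "'a::field \<Rightarrow> 'a \<Rightarrow> 'a \<Rightarrow> 'a \<Rightarrow> 'a \<Rightarrow> 'a \<Rightarrow> 'a \<Rightarrow> 'a \<Rightarrow> 'a" where
  "qP_f \<Theta>0 \<Theta>1 \<Theta>t \<Theta>inf y Z t q = (let X = qP_X \<Theta>1 y Z t q in
     1 / y * ((X - t * \<Theta>0) * (X - t * inverse \<Theta>0) / ((X - \<Theta>inf / q) * (X - inverse \<Theta>inf))))"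

definition qP_g :: "'a::field \<Rightarrow> 'a \<Rightarrow> 'a \<Rightarrow> 'a \<Rightarrow> 'a \<Rightarrow> 'a \<Rightarrow> 'a \<Rightarrow> 'a \<Rightarrow> 'a" where
  "qP_g \<Theta>0 \<Theta>1 \<Theta>t \<Theta>inf y Z t q =
     (let X = qP_X \<Theta>1 y Z t q; f = qP_f \<Theta>0 \<Theta>1 \<Theta>t \<Theta>inf y Z t q in
      1 / ((q - 1) * f) *
        ((f - q * t * \<Theta>t) * (f - q * t * inverse \<Theta>t) / (q * (f - 1) * (f - q * t) * X) - 1))"

text \<open>
  Since division is total in HOL, well-definedness of the rational functions above has to be
  stated explicitly: none of the inverted quantities vanishes.
\<close>

definition H_VI_defined :: "'a::field \<Rightarrow> 'a \<Rightarrow> bool" where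
  "H_VI_defined y t \<longleftrightarrow> t \<noteq> 0 \<and> t \<noteq> 1 \<and> y \<noteq> 0 \<and> y \<noteq> 1 \<and> y \<noteq> t"

definition qP_defined :: "'a::field \<Rightarrow> 'a \<Rightarrow> 'a \<Rightarrow> 'a \<Rightarrow> 'a \<Rightarrow> 'a \<Rightarrow> 'a \<Rightarrow> 'a \<Rightarrow> bool" where
  "qP_defined \<Theta>0 \<Theta>1 \<Theta>t \<Theta>inf y Z t q \<longleftrightarrow>
     (let X = qP_X \<Theta>1 y Z t q; f = qP_f \<Theta>0 \<Theta>1 \<Theta>t \<Theta>inf y Z t q in
      \<Theta>0 \<noteq> 0 \<and> \<Theta>1 \<noteq> 0 \<and> \<Theta>t \<noteq> 0 \<and> \<Theta>inf \<noteq> 0 \<and> q \<noteq> 0 \<and> q \<noteq> 1 \<and>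
      y \<noteq> \<Theta>1 \<and> y \<noteq> inverse \<Theta>1 \<and>
      y \<noteq> 0 \<and> X \<noteq> \<Theta>inf / q \<and> X \<noteq> inverse \<Theta>inf \<and>
      f \<noteq> 0 \<and> f \<noteq> 1 \<and> f \<noteq> q * t \<and> X \<noteq> 0)"


section \<open>The rational function fields\<close>

text \<open>
  \<open>pol3\<close> is $C[y][Z][t]$ and \<open>pol4\<close> is $C[y][Z][t][q]$: the innermost polynomial variable is
  \<open>y\<close>, the outermost one is \<open>t\<close> resp. \<open>q\<close>.
\<close>

type_synonym pol3 = "complex poly poly poly"
type_synonym pol4 = "pol3 poly"

definition var_y :: "pol4 fract" where "var_y = to_fract [:[:[:[:0, 1:]:]:]:]"
definition var_Z :: "pol4 fract" where "var_Z = to_fract [:[:[:0, 1:]:]:]"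
definition var_t :: "pol4 fract" where "var_t = to_fract [:[:0, 1:]:]"
definition var_q :: "pol4 fract" where "var_q = to_fract [:0, 1:]"

definition const4 :: "complex \<Rightarrow> pol4 fract" where "const4 c = to_fract [:[:[:[:c:]:]:]:]"

definition Theta :: "complex \<Rightarrow> pol4 fract" where
  "Theta \<theta> = 1 + (var_q - 1) * const4 (\<theta> / 2)"

text \<open>
  A rational function is identified with the value of its formula at the generic point
  \<open>(var_y, var_Z, var_t, var_q)\<close>; the functions of one variable to which \<^const>\<open>qderiv\<close> is
  applied below thus have the other variables fixed.
\<close>

definition dqZ_H :: "complex \<Rightarrow> complex \<Rightarrow> complex \<Rightarrow> complex \<Rightarrow> pol4 fract" where
  "dqZ_H \<theta>0 \<theta>1 \<theta>t \<theta>inf = qderiv var_q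
     (\<lambda>Z. H_VI (const4 \<theta>0) (const4 \<theta>1) (const4 \<theta>t) (const4 \<theta>inf) var_y Z var_t) var_Z"

definition dqy_H :: "complex \<Rightarrow> complex \<Rightarrow> complex \<Rightarrow> complex \<Rightarrow> pol4 fract" where
  "dqy_H \<theta>0 \<theta>1 \<theta>t \<theta>inf = qderiv var_q
     (\<lambda>y. H_VI (const4 \<theta>0) (const4 \<theta>1) (const4 \<theta>t) (const4 \<theta>inf) y var_Z var_t) var_y"

definition rhs_f :: "complex \<Rightarrow> complex \<Rightarrow> complex \<Rightarrow> complex \<Rightarrow> pol4 fract" where
  "rhs_f \<theta>0 \<theta>1 \<theta>t \<theta>inf =
     qP_f (Theta \<theta>0) (Theta \<theta>1) (Theta \<theta>t) (Theta \<theta>inf) var_y var_Z var_t var_q"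

definition rhs_g :: "complex \<Rightarrow> complex \<Rightarrow> complex \<Rightarrow> complex \<Rightarrow> pol4 fract" where
  "rhs_g \<theta>0 \<theta>1 \<theta>t \<theta>inf =
     qP_g (Theta \<theta>0) (Theta \<theta>1) (Theta \<theta>t) (Theta \<theta>inf) var_y var_Z var_t var_q"

definition R1 :: "complex \<Rightarrow> complex \<Rightarrow> complex \<Rightarrow> complex \<Rightarrow> pol4 fract" where
  "R1 \<theta>0 \<theta>1 \<theta>t \<theta>inf = 1 / (var_q - 1) *
     ((rhs_f \<theta>0 \<theta>1 \<theta>t \<theta>inf - var_y) / ((var_q - 1) * var_t) - dqZ_H \<theta>0 \<theta>1 \<theta>t \<theta>inf)"

definition R2 :: "complex \<Rightarrow> complex \<Rightarrow> complex \<Rightarrow> complex \<Rightarrow> pol4 fract" where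
  "R2 \<theta>0 \<theta>1 \<theta>t \<theta>inf = 1 / (var_q - 1) *
     ((rhs_g \<theta>0 \<theta>1 \<theta>t \<theta>inf - var_Z) / ((var_q - 1) * var_t) + dqy_H \<theta>0 \<theta>1 \<theta>t \<theta>inf)"

definition all_defined :: "complex \<Rightarrow> complex \<Rightarrow> complex \<Rightarrow> complex \<Rightarrow> bool" where
  "all_defined \<theta>0 \<theta>1 \<theta>t \<theta>inf \<longleftrightarrow>
     qP_defined (Theta \<theta>0) (Theta \<theta>1) (Theta \<theta>t) (Theta \<theta>inf) var_y var_Z var_t var_q \<and>
     H_VI_defined var_y var_t \<and> H_VI_defined (var_q * var_y) var_t \<and> var_Z \<noteq> 0"


section \<open>Poles\<close>

text \<open>
  \<^const>\<open>quot_of_fract\<close> is the representation of a fraction in lowest terms. In a polynomial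
  ring, which is factorial, the polar divisor is the divisor of the reduced denominator.
\<close>

definition pole_denom :: "'a::{factorial_ring_gcd, semiring_gcd_mult_normalize} fract \<Rightarrow> 'a" where
  "pole_denom R = snd (quot_of_fract R)"

text \<open>The irreducible components, each given by its normalized irreducible equation.\<close>

definition polar_components ::
    "'a::{factorial_ring_gcd, semiring_gcd_mult_normalize} fract \<Rightarrow> 'a set" where
  "polar_components R = prime_factors (pole_denom R)"

definition q_minus_1 :: pol4 where "q_minus_1 = [:-1, 1:]"

lemma prime_q_minus_1: "prime q_minus_1"
proof -
  have *: "q_minus_1 dvd p \<longleftrightarrow> poly p 1 = 0" for p
    using poly_eq_0_iff_dvd[of p 1] by (simp add: q_minus_1_def)
  have "prime_elem q_minus_1"
  proof (rule prime_elemI)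
    show "q_minus_1 \<noteq> 0" by (simp add: q_minus_1_def)
    show "\<not> q_minus_1 dvd 1" by (simp add: *)
  qed (auto simp: *)
  moreover have "normalize q_minus_1 = q_minus_1"
    by (simp add: q_minus_1_def normalize_poly_def unit_factor_poly_def one_pCons [symmetric])
  ultimately show ?thesis by (simp add: prime_def)
qed

text \<open>
  Meaningful only if \<^const>\<open>q_minus_1\<close> is not a polar component of \<open>R\<close>; the denominator of the
  result is then nonzero.
\<close>

definition restrict_q1 :: "pol4 fract \<Rightarrow> pol3 fract" where
  "restrict_q1 R = Fract (poly (fst (quot_of_fract R)) 1) (poly (pole_denom R) 1)"

lemma restrict_q1_denom_nonzero:
  assumes "q_minus_1 \<notin> polar_components R"
  shows "poly (pole_denom R) 1 \<noteq> 0"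
  using assms prime_q_minus_1 poly_eq_0_iff_dvd[of "pole_denom R" 1]
  by (auto simp: polar_components_def in_prime_factors_iff pole_denom_def q_minus_1_def)

definition eval3 :: "pol3 \<Rightarrow> complex \<Rightarrow> complex \<Rightarrow> complex \<Rightarrow> complex" where
  "eval3 p y Z t = poly (poly (poly p [:[:t:]:]) [:Z:]) y"

definition polar_locus :: "pol3 fract \<Rightarrow> (complex \<times> complex \<times> complex) set" where
  "polar_locus R = {(y, Z, t). eval3 (pole_denom R) y Z t = 0}"

definition exceptional_set :: "(complex \<times> complex \<times> complex) set" where
  "exceptional_set =
     {(y, Z, t). y = 0} \<union> {(y, Z, t). y = 1} \<union> {(y, Z, t). y = t} \<union> {(y, Z, t). t = 0}
     \<union> {(y, Z, t). t = 1}"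

end

theory Submission
  imports Defs
begin

text \<open>
  Put \<open>e = q - 1\<close> and let \<open>S\<close> be the ring of fractions whose denominator, restricted to \<open>q = 1\<close>,
  has no zero outside the exceptional set. Then \<open>1 + e S\<close> consists of units of \<open>S\<close>, so an element of
  \<open>S\<close> that is a unit modulo \<open>e\<close> is a unit, and one can compute in \<open>S\<close> modulo \<open>e^3\<close>. At \<open>e = 0\<close>
  the quantities inverted in the modified equation become monomials in \<open>y\<close>, \<open>y - 1\<close>, \<open>y - t\<close>,
  \<open>t - 1\<close> up to sign, so they are all units. Expanding the right-hand sides to second order in \<open>e\<close>
  shows that they agree with Hamilton's equations up to an element of \<open>e^2 S\<close>; that is, both
  remainders lie in \<open>S\<close>. Reducing a fraction only replaces its denominator by a divisor, so
  membership in \<open>S\<close> gives both claims about poles.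
\<close>

section \<open>Arithmetic modulo powers of \<open>e\<close>\<close>

text \<open>The last assumption puts \<open>e\<close> in the Jacobson radical of the subring
  \<open>S\<close>, which makes invertibility in \<open>S\<close> a question modulo \<open>e\<close>
  only.\<close>

locale jet_ring =
  fixes S :: "'a::field set" and e :: 'a
  assumes one_closed: "1 \<in> S"
    and diff_closed: "a \<in> S \<Longrightarrow> b \<in> S \<Longrightarrow> a - b \<in> S"
    and mult_closed: "a \<in> S \<Longrightarrow> b \<in> S \<Longrightarrow> a * b \<in> S"
    and e_closed: "e \<in> S"
    and e_nonzero: "e \<noteq> 0"
    and one_plus_unit: "a \<in> S \<Longrightarrow> 1 + e * a \<noteq> 0 \<and> inverse (1 + e * a) \<in> S"
begin

definition unit :: "'a \<Rightarrow> bool" where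
  "unit u \<longleftrightarrow> u \<in> S \<and> u \<noteq> 0 \<and> inverse u \<in> S"

text \<open>A relation rather than a coefficient map: elements of \<open>S\<close> may themselves
  involve \<open>e\<close>, so \<open>x\<close> does not determine its coefficients. Only the
  congruence modulo \<open>e^3 S\<close> matters.\<close>

definition jet :: "'a \<Rightarrow> 'a \<Rightarrow> 'a \<Rightarrow> 'a \<Rightarrow> bool" where
  "jet x a b c \<longleftrightarrow> a \<in> S \<and> b \<in> S \<and> c \<in> S \<and> (\<exists>r\<in>S. x = a + e * b + e^2 * c + e^3 * r)"

definition jet1 :: "'a \<Rightarrow> 'a \<Rightarrow> 'a \<Rightarrow> bool" where
  "jet1 x a b \<longleftrightarrow> (\<exists>c. jet x a b c)"

lemma zero_closed: "0 \<in> S"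
  using diff_closed[OF one_closed one_closed] by simp

lemma uminus_closed: "a \<in> S \<Longrightarrow> - a \<in> S"
  using diff_closed[OF zero_closed, of a] by simp

lemma add_closed: "a \<in> S \<Longrightarrow> b \<in> S \<Longrightarrow> a + b \<in> S"
  using diff_closed[of a "- b"] uminus_closed by simp

lemma power_closed: "a \<in> S \<Longrightarrow> a ^ n \<in> S"
  by (induction n) (auto intro: one_closed mult_closed)

lemma of_nat_closed: "of_nat n \<in> S"
  by (induction n) (auto intro: zero_closed one_closed add_closed)

lemma numeral_closed: "numeral n \<in> S"
  using of_nat_closed[of "numeral n"] by simp

lemma unit_closed: "unit u \<Longrightarrow> u \<in> S"
  and unit_nonzero: "unit u \<Longrightarrow> u \<noteq> 0"
  by (auto simp: unit_def)

lemma divide_closed: "a \<in> S \<Longrightarrow> unit u \<Longrightarrow> a / u \<in> S"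
  by (auto simp: unit_def divide_inverse intro: mult_closed)

lemma unit_one: "unit 1"
  by (simp add: unit_def one_closed)

lemma unit_mult: "unit u \<Longrightarrow> unit v \<Longrightarrow> unit (u * v)"
  by (auto simp: unit_def inverse_mult_distrib intro: mult_closed)

lemma unit_inverse: "unit u \<Longrightarrow> unit (inverse u)"
  by (auto simp: unit_def)

lemma unit_divide: "unit u \<Longrightarrow> unit v \<Longrightarrow> unit (u / v)"
  by (simp add: divide_inverse unit_mult unit_inverse)

lemma unit_uminus: "unit u \<Longrightarrow> unit (- u)"
  by (auto simp: unit_def intro: uminus_closed)

lemma unit_power: "unit u \<Longrightarrow> unit (u ^ n)"
  by (induction n) (auto intro: unit_one unit_mult)

lemma unit_perturb:
  assumes "unit u" "a \<in> S"
  shows "unit (u + e * a)"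
proof -
  have *: "a / u \<in> S" using assms by (rule divide_closed[rotated])
  have "u + e * a = u * (1 + e * (a / u))"
    using unit_nonzero[OF assms(1)] by (simp add: field_simps)
  moreover have "unit (1 + e * (a / u))"
    using one_plus_unit[OF *] add_closed[OF one_closed mult_closed[OF e_closed *]] by (simp add: unit_def)
  ultimately show ?thesis using assms(1) by (simp add: unit_mult)
qed

lemmas closed =
  zero_closed one_closed numeral_closed add_closed diff_closed uminus_closed mult_closed
  power_closed divide_closed e_closed
lemmas units = unit_one unit_mult unit_divide unit_inverse unit_uminus unit_power

lemma jetI:
  "x = a + e * b + e^2 * c + e^3 * r \<Longrightarrow> a \<in> S \<Longrightarrow> b \<in> S \<Longrightarrow> c \<in> S \<Longrightarrow> r \<in> S \<Longrightarrow> jet x a b c"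
  by (auto simp: jet_def)

lemma jetE:
  assumes "jet x a b c"
  obtains r where "x = a + e * b + e^2 * c + e^3 * r" "a \<in> S" "b \<in> S" "c \<in> S" "r \<in> S"
  using assms by (auto simp: jet_def)

lemma jet_cong:
  "jet x a b c \<Longrightarrow> a = a' \<Longrightarrow> b = b' \<Longrightarrow> c = c' \<Longrightarrow> jet x a' b' c'"
  by simp

lemma jet_const: "a \<in> S \<Longrightarrow> jet a a 0 0"
  by (rule jetI[where r = 0]) (auto intro: closed)

lemma jet_linear: "a \<in> S \<Longrightarrow> b \<in> S \<Longrightarrow> jet (a + e * b) a b 0"
  by (rule jetI[where r = 0]) (auto intro: closed)

lemma jet_unit:
  assumes "jet x a b c" "unit a"
  shows "unit x"
  using assms(1)
proof (rule jetE)
  fix r assume r: "x = a + e * b + e^2 * c + e^3 * r" "a \<in> S" "b \<in> S" "c \<in> S" "r \<in> S"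
  have eq: "x = a + e * (b + e * c + e^2 * r)"
    unfolding r(1) by (simp add: algebra_simps power2_eq_square power3_eq_cube)
  show "unit x"
    unfolding eq by (rule unit_perturb[OF assms(2)]) (use r in \<open>auto intro!: closed\<close>)
qed

lemma jet_add:
  assumes "jet x a b c" "jet x' a' b' c'"
  shows "jet (x + x') (a + a') (b + b') (c + c')"
proof -
  obtain r r' where
    r: "x = a + e * b + e^2 * c + e^3 * r" "a \<in> S" "b \<in> S" "c \<in> S" "r \<in> S" and
    r': "x' = a' + e * b' + e^2 * c' + e^3 * r'" "a' \<in> S" "b' \<in> S" "c' \<in> S" "r' \<in> S"
    using assms by (meson jetE)
  show ?thesis
    by (rule jetI[where r = "r + r'"]) (use r r' in \<open>auto intro!: closed simp: algebra_simps\<close>)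
qed

lemma jet_mult:
  assumes "jet x a b c" "jet x' a' b' c'"
  shows "jet (x * x') (a * a') (a * b' + b * a') (a * c' + b * b' + c * a')"
proof -
  obtain r r' where
    r: "x = a + e * b + e^2 * c + e^3 * r" "a \<in> S" "b \<in> S" "c \<in> S" "r \<in> S" and
    r': "x' = a' + e * b' + e^2 * c' + e^3 * r'" "a' \<in> S" "b' \<in> S" "c' \<in> S" "r' \<in> S"
    using assms by (meson jetE)
  let ?r = "a * r' + b * c' + c * b' + r * a' + e * (b * r' + c * c' + r * b')
              + e^2 * (c * r' + r * c') + e^3 * (r * r')"
  have eq: "x * x' = a * a' + e * (a * b' + b * a') + e^2 * (a * c' + b * b' + c * a') + e^3 * ?r"
    unfolding r(1) r'(1) by algebra
  show ?thesis
    by (rule jetI[OF eq]) (use r r' in \<open>auto intro!: closed\<close>)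
qed

lemma jet_diff:
  assumes "jet x a b c" "jet x' a' b' c'"
  shows "jet (x - x') (a - a') (b - b') (c - c')"
  using jet_add[OF assms(1) jet_mult[OF jet_const[of "-1"] assms(2)]]
  by (simp add: closed)

text \<open>The quotient coefficients are supplied by the caller and verified by multiplying back.
  Each expansion below thus reduces to polynomial identities, without any power series
  division.\<close>

lemma jet_divide:
  assumes x: "jet x n0 n1 n2" and z: "jet z d0 d1 d2" and u: "unit d0"
    and q: "q0 \<in> S" "q1 \<in> S" "q2 \<in> S"
    and eq: "q0 * d0 = n0" "q0 * d1 + q1 * d0 = n1" "q0 * d2 + q1 * d1 + q2 * d0 = n2"
  shows "jet (x / z) q0 q1 q2"
proof -
  define p where "p = q0 + e * q1 + e^2 * q2"
  have uz: "unit z" using jet_unit[OF z u] .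
  have "jet p q0 q1 q2"
    by (rule jetI[where r = 0]) (use q in \<open>auto intro: closed simp: p_def\<close>)
  from jet_mult[OF this z] have "jet (p * z) n0 n1 n2"
    by (rule jet_cong) (use eq in \<open>auto simp: algebra_simps\<close>)
  \<comment> \<open>All three coefficients cancel, so only the remainder term is left; dividing it
    by the unit \<open>z\<close> keeps it in \<open>S\<close>.\<close>
  from jet_diff[OF x this] obtain r where r: "r \<in> S" "x - p * z = e^3 * r"
    by (rule jetE) simp
  then have "x / z = q0 + e * q1 + e^2 * q2 + e^3 * (r / z)"
    using unit_nonzero[OF uz] unfolding p_def by (simp add: field_simps)
  then show ?thesis using q r uz by (auto intro!: jetI[where r = "r / z"] closed)
qed

lemma jet_inverse:
  assumes z: "jet z 1 d1 d2"
  shows "jet (inverse z) 1 (- d1) (d1^2 - d2)"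
proof -
  have "jet (1 / z) 1 (- d1) (d1^2 - d2)"
    using z by (intro jet_divide[OF jet_const z])
      (auto intro!: closed unit_one simp: jet_def algebra_simps power2_eq_square)
  then show ?thesis by (simp add: inverse_eq_divide)
qed

lemma jet_imp_jet1: "jet x a b c \<Longrightarrow> jet1 x a b"
  by (auto simp: jet1_def)

lemma jet1_cong: "jet1 x a b \<Longrightarrow> a = a' \<Longrightarrow> b = b' \<Longrightarrow> jet1 x a' b'"
  by simp

lemma jet1_const: "a \<in> S \<Longrightarrow> jet1 a a 0"
  using jet_const by (auto simp: jet1_def)

lemma jet1_add: "jet1 x a b \<Longrightarrow> jet1 x' a' b' \<Longrightarrow> jet1 (x + x') (a + a') (b + b')"
  unfolding jet1_def by (blast intro: jet_add)

lemma jet1_diff: "jet1 x a b \<Longrightarrow> jet1 x' a' b' \<Longrightarrow> jet1 (x - x') (a - a') (b - b')"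
  unfolding jet1_def by (blast intro: jet_diff)

lemma jet1_mult: "jet1 x a b \<Longrightarrow> jet1 x' a' b' \<Longrightarrow> jet1 (x * x') (a * a') (a * b' + b * a')"
  unfolding jet1_def by (blast intro: jet_mult)

lemma jet1_divide:
  assumes "jet1 x n0 n1" "jet1 z d0 d1" and u: "unit d0"
  shows "jet1 (x / z) (n0 / d0) ((n1 * d0 - n0 * d1) / d0^2)"
proof -
  obtain n2 d2 where x: "jet x n0 n1 n2" and z: "jet z d0 d1 d2" using assms by (auto simp: jet1_def)
  let ?q0 = "n0 / d0" and ?q1 = "(n1 * d0 - n0 * d1) / d0^2"
  \<comment> \<open>The third coefficient solves \<open>q0 * d2 + q1 * d1 + q2 * d0 = n2\<close> for
    \<open>q2\<close>; it is then forgotten.\<close>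
  have "jet (x / z) ?q0 ?q1 ((n2 - ?q0 * d2 - ?q1 * d1) / d0)"
    using x z unit_nonzero[OF u]
    by (intro jet_divide[OF x z u])
      (auto intro!: closed units u elim: jetE, simp_all add: field_simps power2_eq_square)
  then show ?thesis by (auto simp: jet1_def)
qed

lemma jet1E:
  assumes "jet1 x a b"
  obtains r where "r \<in> S" "x = a + e * b + e^2 * r"
proof -
  obtain c r where "c \<in> S" "r \<in> S" "x = a + e * b + e^2 * c + e^3 * r"
    using assms by (auto simp: jet1_def jet_def)
  then show ?thesis
    by (intro that[of "c + e * r"]) (auto intro: closed simp: algebra_simps power2_eq_square power3_eq_cube)
qed

end

section \<open>The modified equation over an abstract jet ring\<close>

text \<open>Here \<open>e\<close> plays the role of \<open>q - 1\<close> and each \<open>c\<close>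
  that of \<theta>/2, whence the doubled parameters in \<open>H\<close>. The assumed units are the
  equations of the exceptional set. \<open>Z\<close> is not among them; it is only nonzero, as the
  q-derivative in \<open>Z\<close> divides by it.\<close>

locale qPVI_jets = jet_ring +
  fixes y Z t c0 c1 ct ci :: 'a
  assumes Z_closed: "Z \<in> S"
    and c_closed: "c0 \<in> S" "c1 \<in> S" "ct \<in> S" "ci \<in> S"
    and y_units: "unit y" "unit (y - 1)" "unit (y - t)"
    and t_units: "unit t" "unit (t - 1)"
    and Z_nonzero: "Z \<noteq> 0"
    and two_nonzero: "(2::'a) \<noteq> 0"
begin

abbreviation "\<Theta> c \<equiv> 1 + e * c"
abbreviation "X \<equiv> qP_X (\<Theta> c1) y Z t (1 + e)"
abbreviation "f \<equiv> qP_f (\<Theta> c0) (\<Theta> c1) (\<Theta> ct) (\<Theta> ci) y Z t (1 + e)"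
abbreviation "g \<equiv> qP_g (\<Theta> c0) (\<Theta> c1) (\<Theta> ct) (\<Theta> ci) y Z t (1 + e)"
abbreviation "H \<equiv> H_VI (2 * c0) (2 * c1) (2 * ct) (2 * ci)"

lemmas vars_units = y_units t_units
lemmas vars_closed = Z_closed c_closed unit_closed[OF y_units(1)] unit_closed[OF t_units(1)]

lemma unit_factors: "y \<noteq> 0" "y \<noteq> 1" "y \<noteq> t" "t \<noteq> 0" "t \<noteq> 1"
  using vars_units[THEN unit_nonzero] by auto

lemma jet_Theta: "c \<in> S \<Longrightarrow> jet (\<Theta> c) 1 c 0"
  by (intro jet_linear) (auto intro: closed)

lemma jet_inverse_Theta: "c \<in> S \<Longrightarrow> jet (inverse (\<Theta> c)) 1 (- c) (c^2)"
  using jet_inverse[OF jet_Theta] by simp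

lemma jet_q: "jet (1 + e) 1 1 0"
  using jet_Theta[of 1] by (simp add: one_closed)

text \<open>The sum of \<Theta> and its inverse is \<open>2 + e^2 * c1^2\<close> modulo
  \<open>e^3\<close>, so the denominator is \<open>(y - 1)^2 - e^2 * c1^2 * y\<close> and has no
  first-order term.\<close>

lemma jet_X:
  "jet X ((y - t) / (y - 1)) ((y - t) / (y - 1) * (y * Z)) ((y - t) / (y - 1) * (c1^2 * y / (y - 1)^2))"
proof -
  have z: "jet ((y - \<Theta> c1) * (y - inverse (\<Theta> c1))) ((y - 1)^2) 0 (- y * c1^2)"
    by (rule jet_cong[OF jet_mult[OF jet_diff jet_diff]])
      (rule jet_const jet_Theta jet_inverse_Theta vars_closed closed vars_units | simp add: algebra_simps power2_eq_square)+
  have "jet (1 + e * (y * Z)) 1 (y * Z) 0"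
    by (intro jet_linear) (auto intro!: closed vars_closed vars_units)
  then have n: "jet ((y - 1) * (y - t) * (1 + (1 + e - 1) * y * Z)) ((y - 1) * (y - t)) ((y - 1) * (y - t) * (y * Z)) 0"
    by (intro jet_cong[OF jet_mult[OF jet_const]]) (auto intro!: closed vars_closed simp: mult.assoc)
  show ?thesis unfolding qP_X_def
  proof (rule jet_divide[OF n z])
    show "unit ((y - 1)^2)" "(y - t) / (y - 1) \<in> S" "(y - t) / (y - 1) * (y * Z) \<in> S"
      "(y - t) / (y - 1) * (c1^2 * y / (y - 1)^2) \<in> S"
      by (intro closed units vars_closed vars_units)+
  qed (use unit_factors in \<open>simp_all add: power2_eq_square\<close>)
qed

text \<open>
  The coefficients of \<open>e\<close> and \<open>e^2\<close> in \<open>f\<close>, and the partial derivatives of \<open>H\<close>. As \<open>g\<close> carries the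
  prefactor \<open>1 / (q - 1)\<close>, its first-order coefficient involves \<open>f2\<close>.
\<close>

definition f1 :: 'a where
  "f1 = y * (y - 1) * (2 * (y - t) * Z + 1) / (t - 1)"

definition f2 :: 'a where
  "f2 = y * (y - 1) * (y - t) / (t - 1)^2 * ((y - t) * (3 * y - 1) * Z^2 + (3 * y - 2) * Z + 1
      + 2 * c1^2 * (t - 1) / (y - 1)^2 - c0^2 * t / y^2 + ci^2 - ci)"

definition H_Z :: 'a where
  "H_Z = y * (y - 1) * (2 * (y - t) * Z + 1) / (t * (t - 1))"

definition H_y :: 'a where
  "H_y = (Z^2 * (3 * y^2 - 2 * (1 + t) * y + t) + Z * (2 * y - 1) - ci^2 + ci) / (t * (t - 1))
    + c0^2 / ((t - 1) * y^2) + ct^2 / (y - t)^2 - c1^2 / (t * (y - 1)^2)"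

lemma f1_closed: "f1 \<in> S" and f2_closed: "f2 \<in> S" and H_Z_closed: "H_Z \<in> S" and H_y_closed: "H_y \<in> S"
  unfolding f1_def f2_def H_Z_def H_y_def
  by (intro closed units vars_closed vars_units)+

text \<open>Again \<Theta> enters only through its sum with its inverse, so \<open>c\<close> first
  appears at second order.\<close>

lemma jet_numerator:
  assumes x: "jet x a b d" and c: "c \<in> S"
  shows "jet ((x - t * \<Theta> c) * (x - t * inverse (\<Theta> c)))
    ((a - t)^2) (2 * (a - t) * b) (b^2 + 2 * (a - t) * d - c^2 * t * a)"
proof -
  have "jet (x - t * \<Theta> c) (a - t) (b - t * c) d"
    by (rule jet_cong[OF jet_diff[OF x jet_mult[OF jet_const jet_Theta]]]) (auto intro: vars_closed c)
  moreover have "jet (x - t * inverse (\<Theta> c)) (a - t) (b + t * c) (d - t * c^2)"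
    by (rule jet_cong[OF jet_diff[OF x jet_mult[OF jet_const jet_inverse_Theta]]]) (auto intro: vars_closed c)
  ultimately show ?thesis
    by (rule jet_cong[OF jet_mult]) (auto simp: algebra_simps power2_eq_square)
qed

text \<open>The two roots have product \<open>1 / q\<close> and sum \<open>2 - e\<close> modulo
  \<open>e^2\<close>. Hence the first-order coefficient is free of \<open>c\<close> but has an extra
  summand \<open>a - 1\<close> coming from \<open>1 / q\<close>.\<close>

lemma jet_denominator:
  assumes x: "jet x a b d" and c: "c \<in> S"
  shows "jet ((x - \<Theta> c / (1 + e)) * (x - inverse (\<Theta> c)))
    ((a - 1)^2) ((a - 1) * (2 * b + 1))
    (b^2 + 2 * (a - 1) * d + b + (a - 1) * (c - 1 - c^2) - c * (c - 1))"
proof -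
  have "jet (\<Theta> c / (1 + e)) 1 (c - 1) (1 - c)"
    by (rule jet_divide[OF jet_Theta[OF c] jet_q unit_one]) (auto intro!: closed c)
  then have "jet (x - \<Theta> c / (1 + e)) (a - 1) (b - (c - 1)) (d - (1 - c))"
    by (rule jet_diff[OF x])
  moreover have "jet (x - inverse (\<Theta> c)) (a - 1) (b + c) (d - c^2)"
    by (rule jet_cong[OF jet_diff[OF x jet_inverse_Theta[OF c]]]) auto
  ultimately show ?thesis
    by (rule jet_cong[OF jet_mult]) (auto simp: algebra_simps power2_eq_square)
qed

lemma jet_f: "jet f y f1 f2"
proof -
  let ?a = "(y - t) / (y - 1)"
  \<comment> \<open>With the leading coefficients factored in this way, their quotient is visibly
    \<open>y\<close>, and the denominator is a unit.\<close>
  have x0: "?a - 1 = - (t - 1) / (y - 1)" "?a - t = - y * (t - 1) / (y - 1)"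
    using unit_factors by (simp_all add: field_simps)
  note N = jet_numerator[OF jet_X c_closed(1), unfolded x0]
  note D = jet_denominator[OF jet_X c_closed(4), unfolded x0]
  have u: "unit ((- (t - 1) / (y - 1))^2)"
    by (intro units vars_units)
  have "jet ((X - t * \<Theta> c0) * (X - t * inverse (\<Theta> c0)) / ((X - \<Theta> ci / (1 + e)) * (X - inverse (\<Theta> ci))))
      (y * y) (y * f1) (y * f2)"
  proof (rule jet_divide[OF N D u])
    show "y * y * (- (t - 1) / (y - 1))\<^sup>2 = (- y * (t - 1) / (y - 1))\<^sup>2"
      using unit_factors by (simp add: divide_simps) algebra
  next
    show "y * y * (- (t - 1) / (y - 1) * (2 * (?a * (y * Z)) + 1)) + y * f1 * (- (t - 1) / (y - 1))\<^sup>2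
      = 2 * (- y * (t - 1) / (y - 1)) * (?a * (y * Z))"
      unfolding f1_def using unit_factors by (simp add: divide_simps) algebra
  next
    show "y * y * ((?a * (y * Z))\<^sup>2 + 2 * (- (t - 1) / (y - 1)) * (?a * (c1\<^sup>2 * y / (y - 1)\<^sup>2)) + ?a * (y * Z)
        + - (t - 1) / (y - 1) * (ci - 1 - ci\<^sup>2) - ci * (ci - 1))
        + y * f1 * (- (t - 1) / (y - 1) * (2 * (?a * (y * Z)) + 1)) + y * f2 * (- (t - 1) / (y - 1))\<^sup>2
      = (?a * (y * Z))\<^sup>2 + 2 * (- y * (t - 1) / (y - 1)) * (?a * (c1\<^sup>2 * y / (y - 1)\<^sup>2)) - c0\<^sup>2 * t * ?a"
      unfolding f1_def f2_def using unit_factors by (simp add: divide_simps) algebra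
  qed (auto intro!: closed f1_closed f2_closed vars_closed)
  \<comment> \<open>The prefactor \<open>1 / y\<close> of \<open>f\<close> removes the common factor
    \<open>y\<close> from all three coefficients.\<close>
  from jet_divide[OF this jet_const[OF vars_closed(6)] vars_units(1) vars_closed(6) f1_closed f2_closed]
  show ?thesis by (simp add: qP_f_def Let_def mult.commute)
qed

text \<open>This is \<open>1 + (q - 1) * f * g\<close>. Recovering \<open>g\<close> from it costs a
  division by \<open>e\<close>, so \<open>B\<close> is needed to one order more than
  \<open>g\<close>.\<close>

definition B :: 'a where
  "B = (f - (1 + e) * t * \<Theta> ct) * (f - (1 + e) * t * inverse (\<Theta> ct))
    / ((1 + e) * (f - 1) * (f - (1 + e) * t) * X)"

lemma g_eq: "g = 1 / (e * f) * (B - 1)"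
  by (simp add: qP_g_def B_def Let_def)

lemma jet_qt: "jet ((1 + e) * t) t t 0"
  by (rule jet_cong[OF jet_mult[OF jet_q jet_const]]) (auto intro: vars_closed)

lemma jet_f_minus:
  shows "jet (f - 1) (y - 1) f1 f2" "jet (f - (1 + e) * t) (y - t) (f1 - t) f2"
  using jet_diff[OF jet_f jet_const[OF one_closed]] jet_diff[OF jet_f jet_qt] by simp_all

text \<open>The coefficients encode \<open>g = Z - e * t * H_y\<close> modulo \<open>e^2\<close>:
  multiplying this by \<open>f = y + e * f1\<close> gives \<open>y * Z\<close> and
  \<open>f1 * Z - y * t * H_y\<close> as the first two coefficients of \<open>f * g\<close>.\<close>

lemma jet_B: "jet B 1 (y * Z) (f1 * Z - y * t * H_y)"
proof -
  have "jet (f - (1 + e) * t * \<Theta> ct) (y - t) (f1 - (t + t * ct)) (f2 - t * ct)"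
    by (rule jet_cong[OF jet_diff[OF jet_f jet_mult[OF jet_qt jet_Theta]]]) (auto intro: vars_closed)
  moreover have "jet (f - (1 + e) * t * inverse (\<Theta> ct)) (y - t) (f1 - (t - t * ct)) (f2 - (t * ct^2 - t * ct))"
    by (rule jet_cong[OF jet_diff[OF jet_f jet_mult[OF jet_qt jet_inverse_Theta]]]) (auto intro: vars_closed)
  ultimately have N: "jet ((f - (1 + e) * t * \<Theta> ct) * (f - (1 + e) * t * inverse (\<Theta> ct)))
      ((y - t)^2) (2 * (y - t) * (f1 - t))
      (2 * (y - t) * f2 + (f1 - t)^2 - t * y * ct^2)"
    by (rule jet_cong[OF jet_mult]) (simp_all add: algebra_simps power2_eq_square)
  let ?v = "y - t" and ?w = "y - 1"
  have "jet ((1 + e) * (f - 1)) ?w (f1 + ?w) (f2 + f1)"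
    by (rule jet_cong[OF jet_mult[OF jet_q jet_f_minus(1)]]) simp_all
  from jet_mult[OF this jet_f_minus(2)]
  have E: "jet ((1 + e) * (f - 1) * (f - (1 + e) * t))
      (?w * ?v) (?w * (f1 - t) + (f1 + ?w) * ?v) (?w * f2 + (f1 + ?w) * (f1 - t) + (f2 + f1) * ?v)" .
  \<comment> \<open>The factor \<open>?v / ?w\<close>, the value of \<open>X\<close> at
    \<open>e = 0\<close>, is pulled out. The leading coefficient becomes \<open>?v^2\<close>, the
    same as in \<open>N\<close>, so \<open>B\<close> starts with 1.\<close>
  have D: "jet ((1 + e) * (f - 1) * (f - (1 + e) * t) * X) (?v^2)
     (?v / ?w * (?w * (f1 - t) + (f1 + ?w) * ?v + ?w * ?v * y * Z))
     (?v / ?w * (?w * f2 + (f1 + ?w) * (f1 - t) + (f2 + f1) * ?v + (?w * (f1 - t) + (f1 + ?w) * ?v) * y * Z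
        + ?v * c1^2 * y / ?w))"
    using unit_factors
    by (intro jet_cong[OF jet_mult[OF E jet_X]]) (simp_all add: power2_eq_square, simp_all add: divide_simps, algebra+)
  show ?thesis unfolding B_def
  proof (rule jet_divide[OF N D])
    show "1 * (?v / ?w * (?w * (f1 - t) + (f1 + ?w) * ?v + ?w * ?v * y * Z)) + y * Z * ?v\<^sup>2
      = 2 * ?v * (f1 - t)"
      unfolding f1_def using unit_factors by (simp add: divide_simps) algebra
  next
    show "1 * (?v / ?w * (?w * f2 + (f1 + ?w) * (f1 - t) + (f2 + f1) * ?v + (?w * (f1 - t) + (f1 + ?w) * ?v) * y * Z
        + ?v * c1^2 * y / ?w)) + y * Z * (?v / ?w * (?w * (f1 - t) + (f1 + ?w) * ?v + ?w * ?v * y * Z))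
        + (f1 * Z - y * t * H_y) * ?v\<^sup>2
      = 2 * ?v * f2 + (f1 - t)^2 - t * y * ct^2"
      unfolding f1_def f2_def H_y_def using unit_factors by (simp add: divide_simps) algebra
  qed (auto intro!: closed vars_closed f1_closed H_y_closed units vars_units)
qed

section \<open>The q-derivatives of the Hamiltonian\<close>

text \<open>The doubled parameters absorb the factor \<open>1 / 4\<close>.\<close>

lemma H_eq:
  "H x z t = x * (x - 1) * (x - t) / (t * (t - 1)) * (z^2 + z / (x - t))
    - ((ci^2 - ci) / (t * (t - 1)) * x + c0^2 / ((t - 1) * x) + ct^2 / (x - t) - c1^2 / (t * (x - 1)))"
proof -
  have "(2::'a) * 2 = 4" by simp
  then have four: "(4::'a) \<noteq> 0" using two_nonzero by (metis mult_eq_0_iff)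
  have *: "1 / 4 * (4 * a / k * x + 4 * b / l + 4 * c / m - 4 * d / n) = a / k * x + b / l + c / m - d / n"
    for a b c d k l m n :: 'a
  proof -
    have factor: "h * a / k * x + h * b / l + h * c / m - h * d / n = h * (a / k * x + b / l + c / m - d / n)" for h
      by (simp add: algebra_simps)
    have "1 / 4 * (4 * u) = u" for u :: 'a using four by simp
    then show ?thesis unfolding factor[of 4] .
  qed
  have "(2 * ci - 1)^2 - 1 = 4 * (ci^2 - ci)" "(2 * c0)^2 = 4 * c0^2"
    "(2 * ct)^2 = 4 * ct^2" "(2 * c1)^2 = 4 * c1^2"
    by (simp_all add: algebra_simps power2_eq_square)
  then show ?thesis
    unfolding H_VI_def by (simp only: *)
qed

text \<open>Exact, since \<open>H\<close> is quadratic in \<open>Z\<close>: the q-derivative of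
  \<open>Z^2\<close> is \<open>(q + 1) * Z = 2 * Z + e * Z\<close>.\<close>

lemma qderiv_Z: "qderiv (1 + e) (\<lambda>Z. H y Z t) Z = H_Z + e * (y * (y - 1) * (y - t) / (t * (t - 1)) * Z)"
  unfolding H_eq qderiv_def H_Z_def
  using unit_factors e_nonzero Z_nonzero by (simp add: divide_simps) algebra

text \<open>First-order Taylor expansion with increment \<open>e * y\<close>, carried out summand by
  summand because \<open>H\<close> has poles in \<open>y\<close>.\<close>

lemma jet1_H_y: "jet1 (H ((1 + e) * y) Z t) (H y Z t) (y * H_y)"
proof -
  let ?Y = "(1 + e) * y"
  have Y: "jet1 ?Y y y"
    using jet_imp_jet1[OF jet_mult[OF jet_q jet_const]] vars_closed by fastforce
  have const: "jet1 (?Y - a) (y - a) y" if "a \<in> S" for a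
    using jet1_diff[OF Y jet1_const[OF that]] by simp
  \<comment> \<open>Covers every simple pole of \<open>H\<close> in \<open>y\<close>; it is applied
    with \<open>k\<close> equal to \<open>t\<close>, 0 and 1, where \<open>y - k\<close> is a
    unit.\<close>
  have pole: "jet1 (a / (b * (?Y - k))) (a / (b * (y - k))) (y * (- a / (b * (y - k)^2)))"
    if "a \<in> S" "unit b" "k \<in> S" "unit (y - k)" for a b k
  proof -
    have d: "jet1 (b * (?Y - k)) (b * (y - k)) (b * y)"
      using jet1_mult[OF jet1_const[OF unit_closed[OF that(2)]] const[OF that(3)]] by simp
    show ?thesis
      using that(2,4)[THEN unit_nonzero]
      by (intro jet1_cong[OF jet1_divide[OF jet1_const[OF that(1)] d unit_mult[OF that(2,4)]]])
        (simp_all add: power2_eq_square ac_simps)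
  qed
  have pole_t: "jet1 (a / (?Y - t)) (a / (y - t)) (y * (- a / (y - t)^2))" if "a \<in> S" for a
    using pole[OF that unit_one] vars_closed vars_units by simp
  have 1: "jet1 (?Y * (?Y - 1) * (?Y - t) / (t * (t - 1)) * (Z^2 + Z / (?Y - t)))
      (y * (y - 1) * (y - t) / (t * (t - 1)) * (Z^2 + Z / (y - t)))
      (y * ((Z^2 * (3 * y^2 - 2 * (1 + t) * y + t) + Z * (2 * y - 1)) / (t * (t - 1))))"
  proof -
    have ts: "unit (t * (t - 1))" by (intro units vars_units)
    have "jet1 (?Y * (?Y - 1) * (?Y - t)) (y * (y - 1) * (y - t)) (y * (3 * y^2 - 2 * (1 + t) * y + t))"
      by (rule jet1_cong[OF jet1_mult[OF jet1_mult[OF Y const] const]])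
        (simp_all add: one_closed vars_closed algebra_simps power2_eq_square)
    from jet1_divide[OF this jet1_const[OF unit_closed[OF ts]] ts]
    have "jet1 (?Y * (?Y - 1) * (?Y - t) / (t * (t - 1))) (y * (y - 1) * (y - t) / (t * (t - 1)))
        (y * (3 * y^2 - 2 * (1 + t) * y + t) / (t * (t - 1)))"
      by (rule jet1_cong) (use unit_nonzero[OF ts] in \<open>simp_all add: power2_eq_square\<close>)
    moreover have "jet1 (Z^2 + Z / (?Y - t)) (Z^2 + Z / (y - t)) (y * (- Z / (y - t)^2))"
      using jet1_add[OF jet1_const[of "Z^2"] pole_t[of Z]] by (simp add: power_closed vars_closed)
    ultimately show ?thesis
      by (rule jet1_cong[OF jet1_mult]) (use unit_factors in \<open>simp, simp add: divide_simps, algebra\<close>)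
  qed
  have k: "(ci^2 - ci) / (t * (t - 1)) \<in> S"
    by (intro closed units vars_closed vars_units)
  have 2: "jet1 ((ci^2 - ci) / (t * (t - 1)) * ?Y) ((ci^2 - ci) / (t * (t - 1)) * y)
      (y * ((ci^2 - ci) / (t * (t - 1))))"
    using jet1_mult[OF jet1_const[OF k] Y] by (simp add: mult.commute)
  have 3: "jet1 (c0^2 / ((t - 1) * ?Y)) (c0^2 / ((t - 1) * y)) (y * (- (c0^2) / ((t - 1) * y^2)))"
    using pole[of "c0^2" "t - 1" 0] by (simp add: power_closed vars_closed vars_units zero_closed)
  have 4: "jet1 (c1^2 / (t * (?Y - 1))) (c1^2 / (t * (y - 1))) (y * (- (c1^2) / (t * (y - 1)^2)))"
    using pole[of "c1^2" t 1] by (simp add: power_closed vars_closed vars_units one_closed)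
  show ?thesis
    unfolding H_eq
    by (rule jet1_cong[OF jet1_diff[OF 1 jet1_diff[OF jet1_add[OF jet1_add[OF 2 3] pole_t[of "ct^2"]] 4]]])
      (simp_all add: power_closed vars_closed H_y_def diff_divide_distrib add_divide_distrib algebra_simps)
qed

text \<open>The divisor \<open>(q - 1) * y\<close> is \<open>e\<close> times a unit, so it costs
  exactly one order in \<open>e\<close>.\<close>

lemma qderiv_y:
  obtains r where "r \<in> S" "qderiv (1 + e) (\<lambda>y. H y Z t) y = H_y + e * r"
proof -
  obtain r where r: "r \<in> S" "H ((1 + e) * y) Z t = H y Z t + e * (y * H_y) + e^2 * r"
    using jet1_H_y by (rule jet1E)
  show ?thesis
  proof (rule that[of "r / y"])
    show "r / y \<in> S" by (intro closed r y_units)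
    show "qderiv (1 + e) (\<lambda>y. H y Z t) y = H_y + e * (r / y)"
      unfolding qderiv_def r(2) using unit_factors e_nonzero
      by (simp add: field_simps power2_eq_square)
  qed
qed

lemma unit_f: "unit f"
  using jet_unit[OF jet_f y_units(1)] .

section \<open>Both remainders lie in \<open>S\<close>\<close>

lemma R1_closed: "1 / e * ((f - y) / (e * t) - qderiv (1 + e) (\<lambda>Z. H y Z t) Z) \<in> S"
proof -
  obtain r where r: "r \<in> S" "f = y + e * f1 + e^2 * r"
    using jet_imp_jet1[OF jet_f] by (rule jet1E)
  let ?d = "y * (y - 1) * (y - t) / (t * (t - 1)) * Z"
  \<comment> \<open>This is Hamilton's equation for \<open>y\<close> at \<open>q = 1\<close>; it
    cancels the terms that are not divisible by \<open>e\<close>.\<close>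
  have f1: "f1 = t * H_Z" using unit_factors by (simp add: f1_def H_Z_def)
  have "1 / e * ((f - y) / (e * t) - (H_Z + e * ?d)) = 1 / e * ((e * (t * H_Z) + e^2 * r) / (e * t) - (H_Z + e * ?d))"
    unfolding r(2) f1 by simp
  also have "\<dots> = r / t - ?d"
  proof -
    \<comment> \<open>\<open>H_Z\<close> and \<open>?d\<close> are replaced by variables, so that
      clearing denominators treats them as atoms.\<close>
    have "1 / e * ((e * (t * h) + e^2 * r) / (e * t) - (h + e * d)) = r / t - d" for h d
      using unit_factors e_nonzero by (simp add: field_simps power2_eq_square)
    then show ?thesis .
  qed
  also have "\<dots> \<in> S" by (intro closed units r vars_closed vars_units)
  finally show ?thesis unfolding qderiv_Z .
qed

lemma R2_closed: "1 / e * ((g - Z) / (e * t) + qderiv (1 + e) (\<lambda>y. H y Z t) y) \<in> S"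
proof -
  obtain r where r: "r \<in> S" "f = y + e * f1 + e^2 * r"
    using jet_imp_jet1[OF jet_f] by (rule jet1E)
  obtain r' where r': "r' \<in> S" "B = 1 + e * (y * Z) + e^2 * (f1 * Z - y * t * H_y) + e^3 * r'"
    using jet_B by (rule jetE)
  obtain r'' where r'': "r'' \<in> S" "qderiv (1 + e) (\<lambda>y. H y Z t) y = H_y + e * r''"
    by (rule qderiv_y)
  have g: "g - Z = (B - 1 - e * f * Z) / (e * f)"
  proof -
    have "1 / (e * F) * (b - 1) - Z = (b - 1 - e * F * Z) / (e * F)" if "F \<noteq> 0" for F b
      using e_nonzero that by (simp add: diff_divide_distrib)
    then show ?thesis unfolding g_eq using unit_nonzero[OF unit_f] by blast
  qed
  \<comment> \<open>In the second-order term \<open>y\<close> is rewritten as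
    \<open>f - e * (f1 + e * r)\<close>, so that the later division by \<open>f\<close> leaves
    exactly \<open>- H_y\<close> to cancel against the q-derivative.\<close>
  have B: "B - 1 - e * f * Z = e^2 * (t * (e * ((r' - r * Z) / t + (f1 + e * r) * H_y) - f * H_y))"
  proof -
    have "t * ((r' - r * Z) / t) = r' - r * Z" using unit_factors by simp
    then show ?thesis unfolding r'(2) r(2) by algebra
  qed
  have "1 / e * ((g - Z) / (e * t) + (H_y + e * r'')) = ((r' - r * Z) / t + (f1 + e * r) * H_y) / f + r''"
  proof -
    have "1 / e * (e^2 * (t * (e * a - F * h)) / (e * F) / (e * t) + (h + e * r'')) = a / F + r''" if "F \<noteq> 0" for a h F
      using unit_factors e_nonzero that by (simp add: field_simps power2_eq_square)
    then show ?thesis unfolding g B using unit_nonzero[OF unit_f] by blast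
  qed
  also have "\<dots> \<in> S"
    by (intro closed r r' r'' vars_closed vars_units unit_f f1_closed H_y_closed)
  finally show ?thesis unfolding r''(2) .
qed

section \<open>Well-definedness of the formulas\<close>

text \<open>Apart from \<open>e\<close> itself, each inverted quantity has a unit as leading
  coefficient, hence is a unit and in particular nonzero.\<close>

lemma qP_is_defined: "qP_defined (\<Theta> c0) (\<Theta> c1) (\<Theta> ct) (\<Theta> ci) y Z t (1 + e)"
proof -
  have "\<Theta> c \<noteq> 0" if "c \<in> S" for c
    using unit_nonzero[OF jet_unit[OF jet_Theta[OF that] unit_one]] .
  moreover have "y - \<Theta> c1 \<noteq> 0" "y - inverse (\<Theta> c1) \<noteq> 0"
    using jet_diff[OF jet_const jet_Theta, THEN jet_unit, THEN unit_nonzero, of y c1]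
      jet_diff[OF jet_const jet_inverse_Theta, THEN jet_unit, THEN unit_nonzero, of y c1]
      vars_closed y_units by auto
  moreover have "1 + e \<noteq> 0" using unit_nonzero[OF jet_unit[OF jet_q unit_one]] .
  \<comment> \<open>The two factors in \<open>X\<close> are handled at once: their product has this
    leading coefficient.\<close>
  moreover have "unit (((y - t) / (y - 1) - 1)^2)"
  proof -
    have eq: "(y - t) / (y - 1) - 1 = - (t - 1) / (y - 1)" using unit_factors by (simp add: field_simps)
    show ?thesis unfolding eq by (intro units vars_units)
  qed
  from unit_nonzero[OF jet_unit[OF jet_denominator[OF jet_X c_closed(4)] this]]
  have "X \<noteq> \<Theta> ci / (1 + e)" "X \<noteq> inverse (\<Theta> ci)" by auto
  moreover have "f - 1 \<noteq> 0" "f - (1 + e) * t \<noteq> 0"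
    using jet_f_minus[THEN jet_unit] y_units unit_nonzero by blast+
  moreover have "X \<noteq> 0"
    using unit_nonzero[OF jet_unit[OF jet_X]] by (auto intro: units y_units)
  ultimately show ?thesis
    using unit_nonzero[OF unit_f] vars_closed unit_factors e_nonzero
    unfolding qP_defined_def Let_def by auto
qed

text \<open>The q-derivative in \<open>y\<close> also evaluates \<open>H\<close> at
  \<open>q * y\<close>, and \<open>q * y - a\<close> differs from the unit \<open>y - a\<close> by a
  multiple of \<open>e\<close>, for \<open>a\<close> equal to 0, 1 and \<open>t\<close>.\<close>

lemma H_VI_is_defined: "H_VI_defined y t" "H_VI_defined ((1 + e) * y) t"
proof -
  show "H_VI_defined y t" using unit_factors by (simp add: H_VI_defined_def)
  have "jet1 ((1 + e) * y - a) (y - a) y" if "a \<in> S" for a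
  proof -
    have "jet ((1 + e) * y - a) (1 * y - a) (1 * 0 + 1 * y - 0) (1 * 0 + 1 * 0 + 0 * y - 0)"
      by (intro jet_diff jet_mult jet_q jet_const that vars_closed)
    then show ?thesis by (auto intro: jet_imp_jet1)
  qed
  then have "(1 + e) * y - a \<noteq> 0" if "a \<in> S" "unit (y - a)" for a
    using that unfolding jet1_def by (metis jet_unit unit_nonzero)
  from this[of 0] this[of 1] this[of t] show "H_VI_defined ((1 + e) * y) t"
    using unit_factors vars_closed vars_units zero_closed one_closed
    by (simp add: H_VI_defined_def)
qed

end

section \<open>Fractions regular along \<open>q = 1\<close> off the exceptional set\<close>

definition nonvanishing :: "pol3 set" where
  "nonvanishing = {p. \<forall>y Z t. (y, Z, t) \<notin> exceptional_set \<longrightarrow> eval3 p y Z t \<noteq> 0}"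

text \<open>A localization of the polynomial ring in four variables, serving as \<open>S\<close>.
  Evaluating the outermost variable at 1 is the restriction to \<open>q = 1\<close>.\<close>

definition regular :: "pol4 fract set" where
  "regular = {Fract a b | a b. poly b 1 \<in> nonvanishing}"

lemma eval3_simps [simp]:
  "eval3 (p + p') y Z t = eval3 p y Z t + eval3 p' y Z t"
  "eval3 (p * p') y Z t = eval3 p y Z t * eval3 p' y Z t"
  "eval3 1 y Z t = 1" "eval3 0 y Z t = 0"
  by (simp_all add: eval3_def)

text \<open>From right to left this makes \<open>regular\<close> a ring; from left to right it gives
  stability under divisors, needed when fractions are reduced.\<close>

lemma nonvanishing_mult_iff: "p * p' \<in> nonvanishing \<longleftrightarrow> p \<in> nonvanishing \<and> p' \<in> nonvanishing"
  by (auto simp: nonvanishing_def)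

lemma one_nonvanishing: "1 \<in> nonvanishing"
  by (simp add: nonvanishing_def)

lemma nonvanishing_nonzero:
  assumes "p \<in> nonvanishing"
  shows "p \<noteq> 0"
proof
  assume "p = 0"
  \<comment> \<open>Any point off the exceptional set would do: here \<open>y = 2\<close> and
    \<open>t = 3\<close> are distinct and differ from 0 and 1.\<close>
  then have "(2, 0, 3) \<in> exceptional_set" using assms by (auto simp: nonvanishing_def)
  then show False by (simp add: exceptional_set_def)
qed

lemma nonvanishing_dvd: "p dvd p' \<Longrightarrow> p' \<in> nonvanishing \<Longrightarrow> p \<in> nonvanishing"
  by (auto simp: nonvanishing_mult_iff)

lemma poly_dvd_poly: "p dvd p' \<Longrightarrow> poly p x dvd poly p' x"
  by (auto elim!: dvdE)

text \<open>Cross-multiplication and coprimality of the reduced pair. It carries information from an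
  arbitrary representation over to the reduced one.\<close>

lemma snd_quot_of_fract_dvd:
  assumes "b \<noteq> 0"
  shows "snd (quot_of_fract (Fract a b)) dvd b"
proof -
  let ?n = "fst (quot_of_fract (Fract a b))" and ?d = "snd (quot_of_fract (Fract a b))"
  have "Fract ?n ?d = Fract a b" by simp
  then have "?n * b = a * ?d" using assms by (subst (asm) eq_fract) auto
  then have "?d dvd ?n * b" by simp
  moreover have "coprime ?d ?n" using coprime_quot_of_fract coprime_commute by blast
  ultimately show ?thesis by (simp add: coprime_dvd_mult_right_iff)
qed

lemma regular_cases:
  assumes "x \<in> regular"
  obtains a b where "x = Fract a b" "poly b 1 \<in> nonvanishing" "b \<noteq> 0"
  using assms nonvanishing_nonzero by (force simp: regular_def)

lemma regular_pole_denom: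
  assumes "R \<in> regular"
  shows "poly (pole_denom R) 1 \<in> nonvanishing"
  using assms
proof (rule regular_cases)
  fix a b assume "R = Fract a b" "poly b 1 \<in> nonvanishing" "b \<noteq> 0"
  then show ?thesis
    unfolding pole_denom_def by (metis snd_quot_of_fract_dvd poly_dvd_poly nonvanishing_dvd)
qed

lemma regular_no_pole:
  assumes "R \<in> regular"
  shows "q_minus_1 \<notin> polar_components R"
proof
  assume "q_minus_1 \<in> polar_components R"
  then have "q_minus_1 dvd pole_denom R" by (auto simp: polar_components_def)
  then have "poly (pole_denom R) 1 = 0"
    using poly_eq_0_iff_dvd[of "pole_denom R" 1] by (simp add: q_minus_1_def)
  then show False using nonvanishing_nonzero[OF regular_pole_denom[OF assms]] by simp
qed

text \<open>Reduction happens twice, before and after setting \<open>q = 1\<close>. Either time the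
  denominator is replaced by a divisor, which creates no zeros.\<close>

lemma regular_polar_locus:
  assumes "R \<in> regular"
  shows "polar_locus (restrict_q1 R) \<subseteq> exceptional_set"
proof -
  have *: "poly (pole_denom R) 1 \<in> nonvanishing" by (rule regular_pole_denom[OF assms])
  have "pole_denom (restrict_q1 R) dvd poly (pole_denom R) 1"
    unfolding restrict_q1_def pole_denom_def[of "Fract _ _"]
    by (rule snd_quot_of_fract_dvd[OF nonvanishing_nonzero[OF *]])
  then have "pole_denom (restrict_q1 R) \<in> nonvanishing" using * by (rule nonvanishing_dvd)
  then show ?thesis by (auto simp: polar_locus_def nonvanishing_def)
qed

lemma q_minus_1_eq: "var_q - 1 = to_fract q_minus_1"
  unfolding var_q_def q_minus_1_def to_fract_1[symmetric] to_fract_diff[symmetric]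
  by (simp add: one_pCons)

lemma to_fract_regular: "to_fract p \<in> regular"
  unfolding regular_def to_fract_def using one_nonvanishing by fastforce

section \<open>The generic point as an instance\<close>

lemma jet_ring_regular: "jet_ring regular (var_q - 1)"
proof
  show "1 \<in> regular" using to_fract_regular[of 1] by simp
next
  fix x x' assume "x \<in> regular" "x' \<in> regular"
  then obtain a b a' b' where *: "x = Fract a b" "poly b 1 \<in> nonvanishing" "b \<noteq> 0"
    "x' = Fract a' b'" "poly b' 1 \<in> nonvanishing" "b' \<noteq> 0"
    by (metis regular_cases)
  have "Fract a'' (b * b') \<in> regular" for a''
    using *(2,5) nonvanishing_mult_iff unfolding regular_def by (metis (mono_tags, lifting) mem_Collect_eq poly_mult)
  then show "x - x' \<in> regular" "x * x' \<in> regular"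
    using * by simp_all
next
  show "var_q - 1 \<in> regular" "var_q - 1 \<noteq> 0"
    unfolding q_minus_1_eq by (rule to_fract_regular) (simp add: q_minus_1_def)
next
  fix x assume "x \<in> regular"
  then obtain a b where *: "x = Fract a b" "poly b 1 \<in> nonvanishing" "b \<noteq> 0"
    by (rule regular_cases)
  \<comment> \<open>The numerator of \<open>1 + e * x\<close>; at \<open>q = 1\<close> it coincides
    with \<open>b\<close>, so it may serve as a denominator.\<close>
  let ?c = "b + q_minus_1 * a"
  have c: "poly ?c 1 \<in> nonvanishing" using * by (simp add: q_minus_1_def)
  then have c0: "?c \<noteq> 0" using nonvanishing_nonzero by fastforce
  have eq: "1 + (var_q - 1) * x = Fract ?c b"
    unfolding q_minus_1_eq *(1) using *(3) by (simp add: to_fract_def One_fract_def)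
  have "Fract b ?c \<in> regular" using c unfolding regular_def by blast
  then show "1 + (var_q - 1) * x \<noteq> 0 \<and> inverse (1 + (var_q - 1) * x) \<in> regular"
    unfolding eq using c0 *(3) by (simp add: Zero_fract_def eq_fract)
qed

lemma unit_to_fract:
  assumes "poly p 1 \<in> nonvanishing"
  shows "jet_ring.unit regular (to_fract p)"
proof -
  have "Fract 1 p \<in> regular" using assms unfolding regular_def by blast
  moreover have "p \<noteq> 0" using assms nonvanishing_nonzero by force
  moreover have "inverse (to_fract p) = Fract 1 p" by (simp add: to_fract_def)
  ultimately show ?thesis
    unfolding jet_ring.unit_def[OF jet_ring_regular] by (simp add: to_fract_regular)
qed

lemma const4_double: "const4 \<theta> = 2 * const4 (\<theta> / 2)"
  unfolding const4_def mult_2 to_fract_add[symmetric] by simp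

text \<open>The required units are polynomials not involving \<open>q\<close>, whose zero sets are
  precisely the five components of the exceptional set.\<close>

lemma qPVI_jets_regular:
  "qPVI_jets regular (var_q - 1) var_y var_Z var_t (const4 c0) (const4 c1) (const4 ct) (const4 ci)"
proof (intro qPVI_jets.intro jet_ring_regular qPVI_jets_axioms.intro)
  show "var_Z \<in> regular" "var_Z \<noteq> 0" by (simp_all add: var_Z_def to_fract_regular)
  show "const4 c0 \<in> regular" "const4 c1 \<in> regular" "const4 ct \<in> regular" "const4 ci \<in> regular"
    by (simp_all add: const4_def to_fract_regular)
  have 2: "(2 :: pol4 fract) = to_fract 2"
    unfolding one_add_one[symmetric] to_fract_1[symmetric] to_fract_add[symmetric] ..
  show "(2 :: pol4 fract) \<noteq> 0" unfolding 2 by simp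
  show "jet_ring.unit regular var_y" unfolding var_y_def
    by (rule unit_to_fract) (auto simp: nonvanishing_def eval3_def exceptional_set_def)
  show "jet_ring.unit regular var_t" unfolding var_t_def
    by (rule unit_to_fract) (auto simp: nonvanishing_def eval3_def exceptional_set_def)
  show "jet_ring.unit regular (var_y - 1)" unfolding var_y_def to_fract_1[symmetric] to_fract_diff[symmetric]
    by (rule unit_to_fract) (auto simp: nonvanishing_def eval3_def exceptional_set_def)
  show "jet_ring.unit regular (var_t - 1)" unfolding var_t_def to_fract_1[symmetric] to_fract_diff[symmetric]
    by (rule unit_to_fract) (auto simp: nonvanishing_def eval3_def exceptional_set_def)
  show "jet_ring.unit regular (var_y - var_t)" unfolding var_y_def var_t_def to_fract_diff[symmetric]
    by (rule unit_to_fract) (auto simp: nonvanishing_def eval3_def exceptional_set_def)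
qed

theorem theorem3p2:
  fixes \<theta>0 \<theta>1 \<theta>t \<theta>inf :: complex
  shows "all_defined \<theta>0 \<theta>1 \<theta>t \<theta>inf \<and>
    (\<forall>y' Z'.
       y' = rhs_f \<theta>0 \<theta>1 \<theta>t \<theta>inf \<and> Z' = rhs_g \<theta>0 \<theta>1 \<theta>t \<theta>inf \<longleftrightarrow>
       (y' - var_y) / ((var_q - 1) * var_t)
         = dqZ_H \<theta>0 \<theta>1 \<theta>t \<theta>inf + (var_q - 1) * R1 \<theta>0 \<theta>1 \<theta>t \<theta>inf \<and>
       (Z' - var_Z) / ((var_q - 1) * var_t)
         = - dqy_H \<theta>0 \<theta>1 \<theta>t \<theta>inf + (var_q - 1) * R2 \<theta>0 \<theta>1 \<theta>t \<theta>inf) \<and>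
    (\<forall>R \<in> {R1 \<theta>0 \<theta>1 \<theta>t \<theta>inf, R2 \<theta>0 \<theta>1 \<theta>t \<theta>inf}.
       q_minus_1 \<notin> polar_components R \<and>
       polar_locus (restrict_q1 R) \<subseteq> exceptional_set)"
proof -
  \<comment> \<open>The parameters are halved because \<Theta> is
    \<open>1 + (q - 1) * \<theta> / 2\<close>; \<open>const4_double\<close> undoes the halving
    inside \<open>H\<close>.\<close>
  interpret qPVI_jets regular "var_q - 1" var_y var_Z var_t
    "const4 (\<theta>0 / 2)" "const4 (\<theta>1 / 2)" "const4 (\<theta>t / 2)" "const4 (\<theta>inf / 2)"
    by (rule qPVI_jets_regular)
  have q: "1 + (var_q - 1) = var_q" by simp
  have Theta: "1 + (var_q - 1) * const4 (\<theta> / 2) = Theta \<theta>" for \<theta>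
    by (simp add: Theta_def)
  have "R1 \<theta>0 \<theta>1 \<theta>t \<theta>inf \<in> regular"
    using R1_closed unfolding R1_def rhs_f_def dqZ_H_def q Theta const4_double[symmetric] .
  moreover have "R2 \<theta>0 \<theta>1 \<theta>t \<theta>inf \<in> regular"
    using R2_closed unfolding R2_def rhs_g_def dqy_H_def q Theta const4_double[symmetric] .
  moreover have "all_defined \<theta>0 \<theta>1 \<theta>t \<theta>inf"
    using qP_is_defined H_VI_is_defined Z_nonzero unfolding all_defined_def q Theta by blast
  \<comment> \<open>Solving the definition of the remainder for the right-hand side only requires
    cancelling the nonzero factors \<open>q - 1\<close> and \<open>t\<close>.\<close>
  moreover have "y' = rhs_f \<theta>0 \<theta>1 \<theta>t \<theta>inf \<longleftrightarrow> (y' - var_y) / ((var_q - 1) * var_t)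
      = dqZ_H \<theta>0 \<theta>1 \<theta>t \<theta>inf + (var_q - 1) * R1 \<theta>0 \<theta>1 \<theta>t \<theta>inf" for y'
    using e_nonzero unit_factors(4) by (simp add: R1_def divide_cancel_right)
  moreover have "Z' = rhs_g \<theta>0 \<theta>1 \<theta>t \<theta>inf \<longleftrightarrow> (Z' - var_Z) / ((var_q - 1) * var_t)
      = - dqy_H \<theta>0 \<theta>1 \<theta>t \<theta>inf + (var_q - 1) * R2 \<theta>0 \<theta>1 \<theta>t \<theta>inf" for Z'
    using e_nonzero unit_factors(4) by (simp add: R2_def divide_cancel_right)
  ultimately show ?thesis using regular_no_pole regular_polar_locus by blast
qed

end
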